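(* Let $X$ be a nonempty completely metrizable space with no isolated points. Then $$\mathrm{cov}(\mathcal M_X) = \begin{cases} \mathrm{cov}(\mathcal M) & \text{if } w_\downarrow(X) = \aleph_0,\\ \aleph_1 & \text{if } w_\downarrow(X) > \aleph_0.\end{cases}$$
   Context: For a topological space $X$, $\mathcal M_X$ is the collection of all meager subsets of $X$ (countable unions of nowhere dense sets), and $\mathcal M = \mathcal M_{\mathbb R}$. For an ideal $\mathcal I$ of subsets of a set $X$, $\mathrm{cov}(\mathcal I) = \min\{|\mathcal J| : \mathcal J \subseteq \mathcal I \text{ and } \bigcup \mathcal J = X\}$. The weight $w(X)$ of a space $X$ is the minimum cardinality of a basis for $X$, and $w_\downarrow(X) = \min\{\kappa : \text{some nonempty open } U \subseteq X \text{ has weight } \kappa\}$. *)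

theory Defs
  imports "HOL-Analysis.Analysis"
begin

(* Set_Algebras uses the same infix for elementhood in a set. *)
no_notation elt_set_eq (infix \<open>=o\<close> 50)
unbundle cardinal_syntax

text \<open>
  Cardinals are represented by cardinal orders, compared by \<^term>\<open>(=o)\<close>, \<^term>\<open>(\<le>o)\<close> and
  \<^term>\<open>(<o)\<close>, also across types; \<^term>\<open>natLeq\<close> is the first infinite cardinal and
  \<^term>\<open>cardSuc natLeq\<close> the second. The least element of a nonempty set of cardinals exists
  (lemma \<open>min_cardinal_least\<close> below), but as a relation it is unique only up to
  \<^term>\<open>(=o)\<close>; hence the choice.
\<close>

definition min_cardinal :: "'b rel set \<Rightarrow> 'b rel" where
  "min_cardinal R = (SOME r. r \<in> R \<and> (\<forall>s\<in>R. r \<le>o s))"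

lemma min_cardinal_least:
  assumes "R \<noteq> {}" "\<forall>r\<in>R. Card_order r"
  shows "min_cardinal R \<in> R" "\<forall>s\<in>R. min_cardinal R \<le>o s"
proof -
  have "\<exists>r. r \<in> R \<and> (\<forall>s\<in>R. r \<le>o s)"
    using exists_minim_Card_order[OF assms] by blast
  from someI_ex[OF this] show "min_cardinal R \<in> R" "\<forall>s\<in>R. min_cardinal R \<le>o s"
    unfolding min_cardinal_def by blast+
qed

definition cov :: "'a set \<Rightarrow> 'a set set \<Rightarrow> 'a set rel" where
  "cov S I = min_cardinal {|J| | J. J \<subseteq> I \<and> \<Union>J = S}"

definition nowhere_dense_in :: "'a topology \<Rightarrow> 'a set \<Rightarrow> bool" where
  "nowhere_dense_in X A \<longleftrightarrow> A \<subseteq> topspace X \<and> X interior_of (X closure_of A) = {}"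

definition meager_sets :: "'a topology \<Rightarrow> 'a set set" where
  "meager_sets X = {A. (countable union_of nowhere_dense_in X) A}"

definition cov_meager :: "'a topology \<Rightarrow> 'a set rel" where
  "cov_meager X = cov (topspace X) (meager_sets X)"

definition is_basis :: "'a topology \<Rightarrow> 'a set set \<Rightarrow> bool" where
  "is_basis X B \<longleftrightarrow> openin X = arbitrary union_of (\<lambda>V. V \<in> B)"

definition weight :: "'a topology \<Rightarrow> 'a set rel" where
  "weight X = min_cardinal {|B| | B. is_basis X B}"

definition weight_down :: "'a topology \<Rightarrow> 'a set rel" where
  "weight_down X =
    min_cardinal {weight (subtopology X U) | U. openin X U \<and> U \<noteq> {}}"

end

theory Submission
  imports Defs "HOL-Library.Sublist"
begin

text \<open>
  Covering numbers are compared by maps under which preimages of nowhere dense sets are nowhere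
  dense. Every crowded metrizable space \<open>X\<close> has such a map into the Baire space of sequences of
  natural numbers: it concatenates finite strings that are chosen one after the other on ever finer
  disjoint families of open sets, each time so that all strings occur inside every member of the
  family. The Baire space in turn has such a map into every nonempty second countable open subset of
  a completely metrizable space, given by a scheme of nested balls. With the composition both
  inequalities between \<open>cov (M_X)\<close> and \<open>cov (M)\<close> follow by exchanging the roles of \<open>X\<close> and the reals.

  If no nonempty open set is second countable, each one contains uncountably many disjoint
  nonempty open sets. Picking \<open>\<aleph>\<^sub>1\<close> of them inside each ball of a countable union of disjoint
  families of balls, the set of points that avoid everything with index \<open>i\<close> is nowhere dense, and since
  a point meets only countably many indices, these \<open>\<aleph>\<^sub>1\<close> sets cover. Baire's theorem
  gives the lower bound.
\<close>

section \<open>Covering numbers and weights\<close>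

lemma countable_card_le_natLeq: "countable A \<longleftrightarrow> |A| \<le>o natLeq"
proof -
  have "countable A \<longleftrightarrow> |A| \<le>o |UNIV :: nat set|"
    unfolding countable_def card_of_ordLeq[symmetric] by auto
  then show ?thesis
    using card_of_nat ordLeq_ordIso_trans ordIso_symmetric by blast
qed

text \<open>The hypotheses supply one cover, so the minimum is taken over a nonempty set of
  cardinals; over the empty set the choice in \<open>min_cardinal\<close> would say nothing.\<close>

lemma cov_attained:
  assumes "J \<subseteq> I" "\<Union>J = S"
  obtains K where "K \<subseteq> I" "\<Union>K = S" "cov S I = |K|"
proof -
  have "cov S I \<in> {|J| | J. J \<subseteq> I \<and> \<Union>J = S}"
    unfolding cov_def using assms by (intro min_cardinal_least) (auto simp: card_of_Card_order)
  then show thesis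
    using that by auto
qed

lemma cov_least:
  assumes "J \<subseteq> I" "\<Union>J = S"
  shows "cov S I \<le>o |J|"
proof -
  have "\<forall>s\<in>{|J| | J. J \<subseteq> I \<and> \<Union>J = S}. cov S I \<le>o s"
    unfolding cov_def using assms by (intro min_cardinal_least) (auto simp: card_of_Card_order)
  then show ?thesis
    using assms by blast
qed

lemma is_basis_openin: "is_basis X {U. openin X U}"
  unfolding is_basis_def by (rule ext) (auto simp: union_of_def arbitrary_def)

lemma weight_attained:
  obtains B where "is_basis X B" "weight X = |B|"
proof -
  have "weight X \<in> {|B| | B. is_basis X B}"
    unfolding weight_def using is_basis_openin by (intro min_cardinal_least) (auto simp: card_of_Card_order)
  then show thesis
    using that by auto
qed

lemma weight_least:
  assumes "is_basis X B"
  shows "weight X \<le>o |B|"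
proof -
  have "\<forall>s\<in>{|B| | B. is_basis X B}. weight X \<le>o s"
    unfolding weight_def using assms by (intro min_cardinal_least) (auto simp: card_of_Card_order)
  then show ?thesis
    using assms by blast
qed

lemma Card_order_weight: "Card_order (weight X)"
  by (metis weight_attained card_of_Card_order)

lemma weight_down_attained:
  assumes "topspace X \<noteq> {}"
  obtains U where "openin X U" "U \<noteq> {}" "weight_down X = weight (subtopology X U)"
proof -
  have "weight_down X \<in> {weight (subtopology X U) | U. openin X U \<and> U \<noteq> {}}"
    unfolding weight_down_def using assms Card_order_weight
    by (intro min_cardinal_least) (auto simp: card_of_Card_order)
  then show thesis
    using that by auto
qed

lemma weight_down_least:
  assumes "openin X U" "U \<noteq> {}"
  shows "weight_down X \<le>o weight (subtopology X U)"
proof -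
  have "\<forall>s\<in>{weight (subtopology X U) | U. openin X U \<and> U \<noteq> {}}. weight_down X \<le>o s"
    unfolding weight_down_def using assms Card_order_weight
    by (intro min_cardinal_least) (auto simp: card_of_Card_order)
  then show ?thesis
    using assms by blast
qed

lemma second_countable_iff_weight: "second_countable X \<longleftrightarrow> weight X \<le>o natLeq"
proof
  assume "second_countable X"
  then obtain B where "countable B" "is_basis X B"
    unfolding second_countable is_basis_def by blast
  then show "weight X \<le>o natLeq"
    using weight_least countable_card_le_natLeq ordLeq_transitive by blast
next
  assume "weight X \<le>o natLeq"
  moreover obtain B where "is_basis X B" "weight X = |B|"
    using weight_attained .
  ultimately show "second_countable X"
    unfolding second_countable is_basis_def by (metis countable_card_le_natLeq)
qed

text \<open>A finite basis leaves only finitely many open sets, so the intersection of all open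
  neighbourhoods of a point is open. By the Hausdorff property that intersection is the point alone,
  which would then be isolated.\<close>

lemma infinite_basis:
  assumes "Hausdorff_space X" "topspace X \<noteq> {}" "\<forall>x \<in> topspace X. \<not> openin X {x}" "is_basis X B"
  shows "infinite B"
proof
  assume fin: "finite B"
  obtain x where x: "x \<in> topspace X"
    using assms by blast
  let ?F = "{U. openin X U \<and> x \<in> U}"
  have "{U. openin X U} \<subseteq> Union ` Pow B"
    using assms(4) unfolding is_basis_def by (auto simp: union_of_def arbitrary_def)
  then have "finite {U. openin X U}"
    using fin finite_subset by blast
  then have "finite ?F"
    by (rule rev_finite_subset) auto
  moreover have "?F \<noteq> {}"
    using x openin_topspace by blast
  ultimately have "openin X (\<Inter>?F)"
    by (intro openin_Inter) auto
  moreover have "\<Inter>?F = {x}"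
  proof -
    have "y = x" if "y \<in> \<Inter>?F" for y
    proof (rule ccontr)
      assume "y \<noteq> x"
      moreover have "y \<in> topspace X"
        using that x openin_topspace by blast
      ultimately obtain U V where "openin X U" "openin X V" "x \<in> U" "y \<in> V" "disjnt U V"
        using assms(1) x unfolding Hausdorff_space_def by metis
      then show False
        using that by (auto simp: disjnt_def)
    qed
    then show ?thesis
      by blast
  qed
  ultimately show False
    using assms(3) x by simp
qed

lemma openin_crowded:
  assumes "\<forall>x \<in> topspace X. \<not> openin X {x}" "openin X U"
  shows "\<forall>x \<in> topspace (subtopology X U). \<not> openin (subtopology X U) {x}"
proof
  fix x assume "x \<in> topspace (subtopology X U)"
  then have "x \<in> topspace X"
    by simp
  then show "\<not> openin (subtopology X U) {x}"
    using assms openin_trans_full by metis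
qed

text \<open>The minimum is attained at some open \<open>U\<close>. As a subspace \<open>U\<close> is
  again Hausdorff and without isolated points, so \<open>infinite_basis\<close> applies to
  it.\<close>

lemma natLeq_le_weight_down:
  assumes "Hausdorff_space X" "topspace X \<noteq> {}" "\<forall>x \<in> topspace X. \<not> openin X {x}"
  shows "natLeq \<le>o weight_down X"
proof -
  obtain U where U: "openin X U" "U \<noteq> {}" "weight_down X = weight (subtopology X U)"
    using weight_down_attained assms(2) .
  obtain B where B: "is_basis (subtopology X U) B" "weight (subtopology X U) = |B|"
    using weight_attained .
  have "topspace (subtopology X U) \<noteq> {}"
    using U openin_subset by fastforce
  then have "infinite B"
    using infinite_basis[OF _ _ openin_crowded[OF assms(3) U(1)] B(1)] assms(1)
      Hausdorff_space_subtopology by blast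
  then show ?thesis
    using U(3) B(2) infinite_iff_natLeq_ordLeq by metis
qed

section \<open>Nowhere dense sets and covers by meager sets\<close>

lemma nowhere_dense_in_iff:
  "nowhere_dense_in X A \<longleftrightarrow> A \<subseteq> topspace X \<and>
    (\<forall>U. openin X U \<and> U \<noteq> {} \<longrightarrow> (\<exists>V\<subseteq>U. openin X V \<and> V \<noteq> {} \<and> V \<inter> A = {}))"
  (is "_ \<longleftrightarrow> _ \<and> ?R")
proof (cases "A \<subseteq> topspace X")
  case True
  have "X interior_of (X closure_of A) = {} \<longleftrightarrow> ?R"
  proof
    assume L: "X interior_of (X closure_of A) = {}"
    show ?R
    proof (intro allI impI)
      fix U assume U: "openin X U \<and> U \<noteq> {}"
      then have "\<not> U \<subseteq> X closure_of A"
        using L interior_of_maximal by blast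
      then have "openin X (U - X closure_of A)" "U - X closure_of A \<noteq> {}"
        using U closedin_closure_of openin_diff by blast+
      moreover have "(U - X closure_of A) \<inter> A = {}"
        using closure_of_subset[OF True] by blast
      ultimately show "\<exists>V\<subseteq>U. openin X V \<and> V \<noteq> {} \<and> V \<inter> A = {}"
        by blast
    qed
  next
    assume R: ?R
    show "X interior_of (X closure_of A) = {}"
    proof (rule ccontr)
      assume "X interior_of (X closure_of A) \<noteq> {}"
      \<comment> \<open>An open set disjoint from \<open>A\<close> is disjoint from the closure of
        \<open>A\<close> as well, whereas this \<open>V\<close> lies inside that closure.\<close>
      then obtain V where V: "V \<subseteq> X interior_of (X closure_of A)" "openin X V" "V \<noteq> {}" "V \<inter> A = {}"
        using R openin_interior_of by metis
      then have "V \<inter> X closure_of A = {}"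
        using openin_Int_closure_of_eq_empty by blast
      then show False
        using V(1,3) interior_of_subset[of X "X closure_of A"] by auto
    qed
  qed
  then show ?thesis
    using True by (simp add: nowhere_dense_in_def)
qed (simp add: nowhere_dense_in_def)

lemma nowhere_dense_in_singleton:
  assumes "t1_space X" "\<forall>x \<in> topspace X. \<not> openin X {x}" "x \<in> topspace X"
  shows "nowhere_dense_in X {x}"
proof -
  have "X closure_of {x} = {x}"
    using assms closure_of_eq t1_space_closedin_singleton by metis
  moreover have "X interior_of {x} \<noteq> {x}"
    using assms openin_interior_of by metis
  ultimately show ?thesis
    unfolding nowhere_dense_in_def using assms(3) interior_of_subset[of X "{x}"] by auto
qed

text \<open>Without isolated points the closed singletons are nowhere dense. They form a meager
  cover, so a least one exists.\<close>

lemma cov_meager_attained: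
  assumes "t1_space X" "\<forall>x \<in> topspace X. \<not> openin X {x}"
  obtains J where "J \<subseteq> meager_sets X" "\<Union>J = topspace X" "cov_meager X = |J|"
proof -
  have "(\<lambda>x. {x}) ` topspace X \<subseteq> meager_sets X"
    using nowhere_dense_in_singleton[OF assms] countable_union_of_inc
    unfolding meager_sets_def by (metis image_subsetI mem_Collect_eq)
  moreover have "\<Union>((\<lambda>x. {x}) ` topspace X) = topspace X"
    by blast
  ultimately show thesis
    using that cov_attained unfolding cov_meager_def by metis
qed

text \<open>A countable cover by meager sets splits into countably many nowhere dense sets. Their
  closures still have empty interior and cover the space, against Baire's theorem.\<close>

lemma uncountable_meager_cover:
  assumes X: "completely_metrizable_space X" "topspace X \<noteq> {}"
    and J: "J \<subseteq> meager_sets X" "\<Union>J = topspace X"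
  shows "uncountable J"
proof
  assume "countable J"
  have "\<exists>\<G>. countable \<G> \<and> \<G> \<subseteq> Collect (nowhere_dense_in X) \<and> \<Union>\<G> = A" if "A \<in> J" for A
    using that J(1) unfolding meager_sets_def union_of_def by blast
  then obtain \<G> where \<G>: "\<And>A. A \<in> J \<Longrightarrow> countable (\<G> A) \<and> \<G> A \<subseteq> Collect (nowhere_dense_in X) \<and> \<Union>(\<G> A) = A"
    by metis
  let ?H = "(\<lambda>A. X closure_of A) ` (\<Union>A\<in>J. \<G> A)"
  have "X interior_of \<Union>?H = {}"
  proof (rule Baire_category_alt)
    show "countable ?H"
      using \<open>countable J\<close> \<G> by auto
    fix T assume "T \<in> ?H"
    then obtain A G where "A \<in> J" "G \<in> \<G> A" "T = X closure_of G"
      by blast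
    then show "closedin X T \<and> X interior_of T = {}"
      using \<G>[of A] by (auto simp: nowhere_dense_in_def)
  qed (use X in blast)
  moreover have "\<Union>?H = topspace X"
  proof
    show "\<Union>?H \<subseteq> topspace X"
      by (auto simp: closure_of_subset_topspace[THEN subsetD])
    show "topspace X \<subseteq> \<Union>?H"
    proof
      fix x assume "x \<in> topspace X"
      then obtain A where "A \<in> J" "x \<in> A"
        using J by blast
      then obtain G where "G \<in> \<G> A" "x \<in> G"
        using \<G> by blast
      moreover have "nowhere_dense_in X G"
        using \<G>[OF \<open>A \<in> J\<close>] \<open>G \<in> \<G> A\<close> by blast
      then have "G \<subseteq> X closure_of G"
        by (intro closure_of_subset) (simp add: nowhere_dense_in_def)
      ultimately show "x \<in> \<Union>?H"
        using \<open>A \<in> J\<close> by blast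
    qed
  qed
  ultimately show False
    using X(2) by simp
qed

text \<open>A cover of \<open>Y\<close> of least size is pulled back along \<open>h\<close>.
  Preimages commute with countable unions, so meager sets pull back to meager sets, and the family
  of preimages is no larger than the original cover.\<close>

lemma cov_meager_le_vimage:
  assumes Y: "t1_space Y" "\<forall>y \<in> topspace Y. \<not> openin Y {y}"
    and h: "h ` topspace X \<subseteq> topspace Y"
    and nd: "\<And>N. nowhere_dense_in Y N \<Longrightarrow> nowhere_dense_in X (h -` N \<inter> topspace X)"
  shows "cov_meager X \<le>o cov_meager Y"
proof -
  obtain J where J: "J \<subseteq> meager_sets Y" "\<Union>J = topspace Y" "cov_meager Y = |J|"
    using cov_meager_attained[OF Y] .
  let ?v = "\<lambda>A. h -` A \<inter> topspace X"
  have "?v A \<in> meager_sets X" if A: "A \<in> meager_sets Y" for A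
  proof -
    obtain \<G> where \<G>: "countable \<G>" "\<G> \<subseteq> Collect (nowhere_dense_in Y)" "\<Union>\<G> = A"
      using A unfolding meager_sets_def union_of_def by blast
    then have "countable (?v ` \<G>)" "?v ` \<G> \<subseteq> Collect (nowhere_dense_in X)" "\<Union>(?v ` \<G>) = ?v A"
      using nd by auto
    then show ?thesis
      unfolding meager_sets_def union_of_def by (intro CollectI exI[of _ "?v ` \<G>"]) auto
  qed
  then have sub: "?v ` J \<subseteq> meager_sets X"
    using J(1) by blast
  have "\<Union>(?v ` J) = h -` (\<Union>J) \<inter> topspace X"
    by (simp add: vimage_Union)
  then have "\<Union>(?v ` J) = topspace X"
    using h J(2) by auto
  then have "cov_meager X \<le>o |?v ` J|"
    unfolding cov_meager_def by (rule cov_least[OF sub])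
  also have "|?v ` J| \<le>o cov_meager Y"
    unfolding J(3) by (rule card_of_image)
  finally show ?thesis .
qed

section \<open>Uncountable disjoint families of open sets\<close>

context Metric_space
begin

text \<open>Zorn's lemma gives a maximal separated subset of \<open>V\<close>. A point of
  \<open>V\<close> at distance at least \<open>\<epsilon>\<close> from all its members could be
  added to it.\<close>

lemma maximal_separated_set:
  assumes "\<epsilon> > 0" "V \<subseteq> M"
  obtains D where "D \<subseteq> V" "pairwise (\<lambda>x y. \<epsilon> \<le> d x y) D" "\<And>x. x \<in> V \<Longrightarrow> \<exists>y\<in>D. d x y < \<epsilon>"
proof -
  let ?A = "{D. D \<subseteq> V \<and> pairwise (\<lambda>x y. \<epsilon> \<le> d x y) D}"
  have "\<exists>D\<in>?A. \<forall>E\<in>?A. D \<subseteq> E \<longrightarrow> E = D"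
  proof (rule subset_Zorn')
    fix C assume "subset.chain ?A C"
    then have C: "C \<subseteq> ?A" "\<forall>D\<in>C. \<forall>E\<in>C. D \<subseteq> E \<or> E \<subseteq> D"
      unfolding subset.chain_def by blast+
    have "pairwise (\<lambda>x y. \<epsilon> \<le> d x y) (\<Union>C)"
    proof (rule pairwiseI)
      fix x y assume "x \<in> \<Union>C" "y \<in> \<Union>C" "x \<noteq> y"
      moreover from this obtain D where "D \<in> C" "x \<in> D" "y \<in> D"
        using C(2) by blast
      ultimately show "\<epsilon> \<le> d x y"
        using C(1) unfolding pairwise_def by blast
    qed
    then show "\<Union>C \<in> ?A"
      using C by blast
  qed
  then obtain D where D: "D \<in> ?A" "\<forall>E\<in>?A. D \<subseteq> E \<longrightarrow> E = D"
    by (rule bexE)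
  have "\<exists>y\<in>D. d x y < \<epsilon>" if "x \<in> V" for x
  proof (rule ccontr)
    assume far: "\<not> (\<exists>y\<in>D. d x y < \<epsilon>)"
    then have "insert x D \<in> ?A"
      using that D(1) commute by (auto simp: pairwise_insert not_less)
    then have "insert x D = D"
      using D(2) by (metis subset_insertI)
    then have "x \<in> D"
      by blast
    then show False
      using far assms that mdist_zero by force
  qed
  then show thesis
    using that D(1) by blast
qed

lemma nonempty_open_contains_ball:
  assumes "openin mtopology U" "U \<noteq> {}"
  obtains x r where "x \<in> M" "r > 0" "mball x r \<subseteq> U"
proof -
  obtain x where "x \<in> U"
    using assms(2) by blast
  then show thesis
    using assms(1) that unfolding openin_mtopology by blast
qed

text \<open>A maximal \<open>2 * \<epsilon>\<close>-separated set works. Separation makes the balls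
  of radius \<open>\<epsilon>\<close> disjoint. Maximality puts a centre within
  \<open>2 * \<epsilon>\<close> of every point, and adding the radius gives the factor 3.\<close>

lemma disjoint_balls_net:
  assumes "\<epsilon> > 0"
  obtains D where "D \<subseteq> M" "pairwise (\<lambda>x y. disjnt (mball x \<epsilon>) (mball y \<epsilon>)) D"
    "\<And>x. x \<in> M \<Longrightarrow> \<exists>y\<in>D. mball y \<epsilon> \<subseteq> mball x (3 * \<epsilon>)"
proof -
  obtain D where D: "D \<subseteq> M" "pairwise (\<lambda>x y. 2 * \<epsilon> \<le> d x y) D"
      "\<And>x. x \<in> M \<Longrightarrow> \<exists>y\<in>D. d x y < 2 * \<epsilon>"
    using maximal_separated_set[of "2 * \<epsilon>" M] assms by auto
  show thesis
  proof
    show "pairwise (\<lambda>x y. disjnt (mball x \<epsilon>) (mball y \<epsilon>)) D"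
      using D(2) by (auto simp: pairwise_def intro!: disjoint_mball)
    fix x assume "x \<in> M"
    then obtain y where "y \<in> D" "d x y < 2 * \<epsilon>"
      using D(3) by blast
    then show "\<exists>y\<in>D. mball y \<epsilon> \<subseteq> mball x (3 * \<epsilon>)"
      using \<open>x \<in> M\<close> by (intro bexI[of _ y] mball_subset) (auto simp: commute)
  qed fact
qed

text \<open>Maximal separated sets at the scales \<open>inverse (Suc n)\<close> are countable by
  assumption, and their union is dense in \<open>V\<close>. Balls of these radii around its points,
  cut down to \<open>V\<close>, form a countable basis.\<close>

lemma second_countable_if_separated_sets_countable:
  assumes "V \<subseteq> M"
    and cnt: "\<And>\<epsilon> S. \<lbrakk>\<epsilon> > 0; S \<subseteq> V; pairwise (\<lambda>x y. \<epsilon> \<le> d x y) S\<rbrakk> \<Longrightarrow> countable S"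
  shows "second_countable (subtopology mtopology V)"
proof -
  have "\<exists>D. D \<subseteq> V \<and> countable D \<and> (\<forall>x\<in>V. \<exists>y\<in>D. d x y < inverse (Suc n))" for n
  proof -
    obtain D where "D \<subseteq> V" "pairwise (\<lambda>x y. inverse (Suc n) \<le> d x y) D"
        "\<And>x. x \<in> V \<Longrightarrow> \<exists>y\<in>D. d x y < inverse (Suc n)"
      using maximal_separated_set[OF _ assms(1)] by (metis inverse_positive_iff_positive of_nat_0_less_iff zero_less_Suc)
    then show ?thesis
      using cnt[of "inverse (Suc n)" D] by auto
  qed
  then obtain D where D: "\<And>n. D n \<subseteq> V" "\<And>n. countable (D n)"
      "\<And>n x. x \<in> V \<Longrightarrow> \<exists>y\<in>D n. d x y < inverse (Suc n)"
    by metis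
  let ?B = "(\<lambda>(q, n). V \<inter> mball q (inverse (Suc n))) ` ((\<Union>n. D n) \<times> UNIV)"
  show ?thesis
    unfolding second_countable_def
  proof (intro exI[of _ ?B] conjI ballI allI impI)
    show "countable ?B"
      using D(2) by auto
    show "openin (subtopology mtopology V) W" if "W \<in> ?B" for W
      using that openin_subtopology_Int2 by fastforce
    fix U x assume "openin (subtopology mtopology V) U \<and> x \<in> U"
    then obtain T where T: "openin mtopology T" "U = T \<inter> V" "x \<in> T" "x \<in> V"
      by (auto simp: openin_subtopology)
    then obtain r where r: "r > 0" "mball x r \<subseteq> T"
      by (auto simp: openin_mtopology)
    \<comment> \<open>With radius below \<open>r / 2\<close>, a ball that contains \<open>x\<close>
      stays inside \<open>mball x r\<close>.\<close>
    obtain n where n: "inverse (Suc n) < r / 2"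
      using reals_Archimedean r(1) half_gt_zero by metis
    obtain q where q: "q \<in> D n" "d x q < inverse (Suc n)"
      using D(3) T(4) by blast
    have "q \<in> M" "x \<in> M"
      using q(1) D(1) T(4) assms(1) by auto
    have "V \<inter> mball q (inverse (Suc n)) \<in> ?B"
      using q(1) by auto
    moreover have "x \<in> V \<inter> mball q (inverse (Suc n))"
      using q T \<open>q \<in> M\<close> \<open>x \<in> M\<close> by (simp add: commute)
    moreover have "mball q (inverse (Suc n)) \<subseteq> mball x r"
      using n q(2) \<open>x \<in> M\<close> by (intro mball_subset) (auto simp: commute)
    moreover from this have "V \<inter> mball q (inverse (Suc n)) \<subseteq> U"
      using T(2) r(2) by blast
    ultimately show "\<exists>W\<in>?B. x \<in> W \<and> W \<subseteq> U"
      by (intro bexI[of _ "V \<inter> mball q (inverse (Suc n))"]) simp_all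
  qed
qed

text \<open>By the previous lemma \<open>V\<close> contains an uncountable
  \<open>\<epsilon>\<close>-separated set for some \<open>\<epsilon>\<close>. Its size is at least
  the first uncountable cardinal, so \<open>I\<close> injects into it, and balls of radius
  \<open>\<epsilon> / 2\<close> around the images are disjoint.\<close>

lemma uncountable_disjoint_open_family:
  assumes V: "openin mtopology V"
    and nsc: "\<not> second_countable (subtopology mtopology V)"
    and I: "|I| \<le>o cardSuc natLeq"
  obtains W where "\<And>i. i \<in> I \<Longrightarrow> openin mtopology (W i) \<and> W i \<noteq> {} \<and> W i \<subseteq> V" "disjoint_family_on W I"
proof -
  have "V \<subseteq> M"
    using V openin_subset by fastforce
  have "\<exists>\<epsilon> S. \<epsilon> > 0 \<and> S \<subseteq> V \<and> pairwise (\<lambda>x y. \<epsilon> \<le> d x y) S \<and> uncountable S"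
  proof (rule ccontr)
    assume *: "\<not> ?thesis"
    have "second_countable (subtopology mtopology V)"
      by (rule second_countable_if_separated_sets_countable[OF \<open>V \<subseteq> M\<close>]) (use * in blast)
    then show False
      using nsc by blast
  qed
  then obtain \<epsilon> S where S: "\<epsilon> > 0" "S \<subseteq> V" "pairwise (\<lambda>x y. \<epsilon> \<le> d x y) S" "uncountable S"
    by blast
  have "natLeq <o |S|"
    using S(4) countable_card_le_natLeq not_ordLeq_iff_ordLess card_of_Well_order natLeq_Well_order
    by blast
  then have "|I| \<le>o |S|"
    using I cardSuc_least natLeq_Card_order card_of_Card_order ordLeq_transitive by blast
  then obtain h where h: "inj_on h I" "h ` I \<subseteq> S"
    unfolding card_of_ordLeq[symmetric] by blast
  show thesis
  proof
    show "openin mtopology (mball (h i) (\<epsilon> / 2) \<inter> V) \<and> mball (h i) (\<epsilon> / 2) \<inter> V \<noteq> {} \<and>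
        mball (h i) (\<epsilon> / 2) \<inter> V \<subseteq> V" if "i \<in> I" for i
    proof -
      have "h i \<in> V" "h i \<in> M"
        using that h S \<open>V \<subseteq> M\<close> by auto
      then have "h i \<in> mball (h i) (\<epsilon> / 2) \<inter> V"
        using S(1) by auto
      then show ?thesis
        using V by blast
    qed
    have "disjnt (mball (h i) (\<epsilon> / 2)) (mball (h j) (\<epsilon> / 2))" if "i \<in> I" "j \<in> I" "i \<noteq> j" for i j
    proof (rule disjoint_mball)
      have "h i \<noteq> h j" "h i \<in> S" "h j \<in> S"
        using h that by (auto dest: inj_onD)
      then show "\<epsilon> / 2 + \<epsilon> / 2 \<le> d (h i) (h j)"
        using S(3) by (auto simp: pairwise_def)
    qed
    then show "disjoint_family_on (\<lambda>i. mball (h i) (\<epsilon> / 2) \<inter> V) I"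
      unfolding disjoint_family_on_def disjnt_def by blast
  qed
qed

text \<open>At each scale \<open>\<epsilon> n\<close> a disjoint family of balls is fixed, and each
  ball receives disjoint open subsets indexed by \<open>I\<close>. Every nonempty open set contains
  one of these balls, hence an open piece of each index.\<close>

lemma nowhere_dense_cover:
  assumes I: "uncountable I"
    and fam: "\<And>V. \<lbrakk>openin mtopology V; V \<noteq> {}\<rbrakk> \<Longrightarrow> \<exists>W. disjoint_family_on W I \<and>
      (\<forall>i\<in>I. openin mtopology (W i) \<and> W i \<noteq> {} \<and> W i \<subseteq> V)"
  obtains Z where "\<And>i. i \<in> I \<Longrightarrow> nowhere_dense_in mtopology (Z i)" "(\<Union>i\<in>I. Z i) = M"
proof -
  define \<epsilon> where "\<epsilon> n = inverse (real (Suc n))" for n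
  have "\<exists>D. D \<subseteq> M \<and> pairwise (\<lambda>x y. disjnt (mball x (\<epsilon> n)) (mball y (\<epsilon> n))) D \<and>
      (\<forall>x\<in>M. \<exists>y\<in>D. mball y (\<epsilon> n) \<subseteq> mball x (3 * \<epsilon> n))" for n
    using disjoint_balls_net[of "\<epsilon> n"] unfolding \<epsilon>_def
    by (metis inverse_positive_iff_positive of_nat_0_less_iff zero_less_Suc)
  then obtain D where D: "\<And>n. D n \<subseteq> M"
      "\<And>n. pairwise (\<lambda>x y. disjnt (mball x (\<epsilon> n)) (mball y (\<epsilon> n))) (D n)"
      "\<And>n x. x \<in> M \<Longrightarrow> \<exists>y\<in>D n. mball y (\<epsilon> n) \<subseteq> mball x (3 * \<epsilon> n)"
    by metis
  from fam obtain W where W: "\<And>V. \<lbrakk>openin mtopology V; V \<noteq> {}\<rbrakk> \<Longrightarrow> disjoint_family_on (W V) I \<and>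
      (\<forall>i\<in>I. openin mtopology (W V i) \<and> W V i \<noteq> {} \<and> W V i \<subseteq> V)"
    by metis
  have ball: "openin mtopology (mball y (\<epsilon> n))" "mball y (\<epsilon> n) \<noteq> {}" if "y \<in> D n" for y n
    using D(1)[of n] that by (auto simp: \<epsilon>_def mball_eq_empty)
  \<comment> \<open>\<open>Z i\<close> avoids all pieces with index \<open>i\<close>, in all balls
    at all scales.\<close>
  define Z where "Z i = {x \<in> M. \<forall>n. \<forall>y\<in>D n. x \<notin> W (mball y (\<epsilon> n)) i}" for i
  show thesis
  proof
    fix i assume "i \<in> I"
    show "nowhere_dense_in mtopology (Z i)"
      unfolding nowhere_dense_in_iff
    proof (intro conjI allI impI)
      show "Z i \<subseteq> topspace mtopology"
        by (auto simp: Z_def)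
      fix U assume "openin mtopology U \<and> U \<noteq> {}"
      then obtain x r where x: "x \<in> M" "r > 0" "mball x r \<subseteq> U"
        using nonempty_open_contains_ball by metis
      obtain n where "inverse (real (Suc n)) < r / 3"
        using reals_Archimedean[of "r / 3"] x(2) by auto
      then have "mball x (3 * \<epsilon> n) \<subseteq> mball x r"
        by (intro mball_subset_concentric) (simp add: \<epsilon>_def)
      moreover obtain y where y: "y \<in> D n" "mball y (\<epsilon> n) \<subseteq> mball x (3 * \<epsilon> n)"
        using D(3) x(1) by blast
      ultimately have sub: "mball y (\<epsilon> n) \<subseteq> U"
        using x(3) by blast
      let ?V = "W (mball y (\<epsilon> n)) i"
      have "openin mtopology ?V" "?V \<noteq> {}" "?V \<subseteq> U"
        using W[OF ball[OF y(1)]] sub \<open>i \<in> I\<close> by blast+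
      moreover have "?V \<inter> Z i = {}"
        using y(1) by (auto simp: Z_def)
      ultimately show "\<exists>V\<subseteq>U. openin mtopology V \<and> V \<noteq> {} \<and> V \<inter> Z i = {}"
        by blast
    qed
  next
    have "x \<in> (\<Union>i\<in>I. Z i)" if "x \<in> M" for x
    proof -
      define bad where "bad n = {i \<in> I. \<exists>y\<in>D n. x \<in> W (mball y (\<epsilon> n)) i}" for n
      \<comment> \<open>At scale \<open>n\<close> the point \<open>x\<close> lies in at most one
        ball, and there in at most one piece. Each scale thus excludes at most one index, and all
        scales together exclude only countably many.\<close>
      have "i = j" if ij: "i \<in> bad n" "j \<in> bad n" for i j n
      proof -
        obtain y z where yz: "y \<in> D n" "z \<in> D n" "i \<in> I" "j \<in> I"
            "x \<in> W (mball y (\<epsilon> n)) i" "x \<in> W (mball z (\<epsilon> n)) j"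
          using ij unfolding bad_def by blast
        then have "x \<in> mball y (\<epsilon> n)" "x \<in> mball z (\<epsilon> n)"
          using W[OF ball] by blast+
        then have "y = z"
          using D(2)[of n] yz(1,2) unfolding pairwise_def disjnt_def by blast
        then show ?thesis
          using W[OF ball[OF yz(1)]] yz unfolding disjoint_family_on_def by blast
      qed
      then have "countable (bad n)" for n
        by (metis countable_finite finite.emptyI finite_insert is_singletonI' is_singleton_def)
      then have "countable (\<Union>n. bad n)"
        by simp
      then have "\<not> I \<subseteq> (\<Union>n. bad n)"
        using I countable_subset by metis
      then obtain i where "i \<in> I" "i \<notin> (\<Union>n. bad n)"
        by blast
      then show ?thesis
        using that by (auto simp: bad_def Z_def)
    qed
    then show "(\<Union>i\<in>I. Z i) = M"
      by (auto simp: Z_def)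
  qed
qed

section \<open>Category-preserving maps to and from the Baire space\<close>

text \<open>Two distinct points of an open set have disjoint open neighbourhoods inside it. One half
  is kept and the other is split again, indefinitely.\<close>

lemma disjoint_open_sequence:
  assumes crowded: "\<forall>x\<in>M. \<not> openin mtopology {x}" and V: "openin mtopology V" "V \<noteq> {}"
  obtains W :: "nat \<Rightarrow> 'a set" where "\<And>n. openin mtopology (W n) \<and> W n \<noteq> {} \<and> W n \<subseteq> V"
    "disjoint_family W"
proof -
  have split: "\<exists>P Q. openin mtopology P \<and> P \<noteq> {} \<and> P \<subseteq> R \<and> openin mtopology Q \<and> Q \<noteq> {} \<and> Q \<subseteq> R \<and> P \<inter> Q = {}"
    if R: "openin mtopology R" "R \<noteq> {}" for R
  proof -
    obtain x where x: "x \<in> R" "x \<in> M"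
      using R openin_subset by fastforce
    then obtain y where y: "y \<in> R" "y \<noteq> x" "y \<in> M"
      using crowded R openin_subset by (metis is_singletonI' is_singleton_def singletonD subsetD topspace_mtopology)
    then obtain P Q where "openin mtopology P" "openin mtopology Q" "x \<in> P" "y \<in> Q" "disjnt P Q"
      using Hausdorff_space_mtopology x unfolding Hausdorff_space_def by (metis topspace_mtopology)
    then show ?thesis
      using R x y by (intro exI[of _ "P \<inter> R"] exI[of _ "Q \<inter> R"]) (auto simp: disjnt_def)
  qed
  \<comment> \<open>\<open>fst (f n)\<close> is the half that is kept; \<open>snd (f n)\<close> is
    the half from which all later sets are cut.\<close>
  have "\<exists>f. \<forall>n::nat. (openin mtopology (snd (f n)) \<and> snd (f n) \<noteq> {} \<and> openin mtopology (fst (f n)) \<and>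
      fst (f n) \<noteq> {} \<and> snd (f n) \<subseteq> V \<and> fst (f n) \<subseteq> V \<and> fst (f n) \<inter> snd (f n) = {}) \<and>
      (fst (f (Suc n)) \<subseteq> snd (f n) \<and> snd (f (Suc n)) \<subseteq> snd (f n))"
  proof (rule dependent_nat_choice)
    show "\<exists>x. openin mtopology (snd x) \<and> snd x \<noteq> {} \<and> openin mtopology (fst x) \<and>
      fst x \<noteq> {} \<and> snd x \<subseteq> V \<and> fst x \<subseteq> V \<and> fst x \<inter> snd x = {}"
      using split[OF V] by auto
  next
    fix x :: "'a set \<times> 'a set" and n :: nat
    assume x: "openin mtopology (snd x) \<and> snd x \<noteq> {} \<and> openin mtopology (fst x) \<and>
      fst x \<noteq> {} \<and> snd x \<subseteq> V \<and> fst x \<subseteq> V \<and> fst x \<inter> snd x = {}"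
    obtain P Q where "openin mtopology P" "P \<noteq> {}" "P \<subseteq> snd x" "openin mtopology Q" "Q \<noteq> {}"
        "Q \<subseteq> snd x" "P \<inter> Q = {}"
      using split[of "snd x"] x by blast
    then show "\<exists>y. (openin mtopology (snd y) \<and> snd y \<noteq> {} \<and> openin mtopology (fst y) \<and>
      fst y \<noteq> {} \<and> snd y \<subseteq> V \<and> fst y \<subseteq> V \<and> fst y \<inter> snd y = {}) \<and>
      (fst y \<subseteq> snd x \<and> snd y \<subseteq> snd x)"
      using x by (intro exI[of _ "(P, Q)"]) auto
  qed
  then obtain f where f: "\<And>n. openin mtopology (fst (f n)) \<and> fst (f n) \<noteq> {} \<and> fst (f n) \<subseteq> V"
      "\<And>n. fst (f n) \<inter> snd (f n) = {}"
      "\<And>n. fst (f (Suc n)) \<subseteq> snd (f n)" "\<And>n. snd (f (Suc n)) \<subseteq> snd (f n)"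
    by blast
  have dec: "snd (f n) \<subseteq> snd (f m)" if "m \<le> n" for m n :: nat
    using lift_Suc_antimono_le[of "\<lambda>n. snd (f n)"] f(4) that by blast
  have "fst (f m) \<inter> fst (f n) = {}" if mn: "m < n" for m n :: nat
  proof -
    obtain k where "n = Suc k" "m \<le> k"
      using mn by (metis less_eq_Suc_le Suc_le_D Suc_le_mono)
    then have "fst (f n) \<subseteq> snd (f m)"
      using f(3) dec by blast
    then show ?thesis
      using f(2) by blast
  qed
  then have "disjoint_family (\<lambda>n. fst (f n))"
    unfolding disjoint_family_on_def by (metis Int_commute linorder_neqE_nat)
  then show thesis
    using that[of "\<lambda>n. fst (f n)"] f(1) by simp
qed

definition nonempty_open :: "'a set \<Rightarrow> bool" where
  "nonempty_open V \<longleftrightarrow> openin mtopology V \<and> V \<noteq> {}"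

text \<open>Equivalently, \<open>c\<close> is locally constant on a dense open subset of the
  space.\<close>

definition locally_decided :: "('a \<Rightarrow> 'b) \<Rightarrow> bool" where
  "locally_decided c \<longleftrightarrow>
    (\<forall>W. nonempty_open W \<longrightarrow> (\<exists>V\<subseteq>W. nonempty_open V \<and> (\<exists>\<sigma>. \<forall>x\<in>V. c x = \<sigma>)))"

text \<open>Each ball of a disjoint net has a nonempty open subset on which \<open>c\<close> has a
  constant value \<open>\<sigma>\<close>. That subset contains countably many disjoint open pieces,
  one for each finite string, and on each piece its string is appended. Every extension of
  \<open>\<sigma>\<close> therefore occurs inside the ball.\<close>

lemma extend_strings:
  fixes c :: "'a \<Rightarrow> nat list"
  assumes crowded: "\<forall>x\<in>M. \<not> openin mtopology {x}" and "\<epsilon> > 0" and c: "locally_decided c"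
  obtains c' where "locally_decided c'" "\<And>x. prefix (c x) (c' x)"
    "\<And>x. x \<in> M \<Longrightarrow> \<exists>\<sigma>. \<forall>\<tau>. \<exists>V \<subseteq> mball x (3 * \<epsilon>). nonempty_open V \<and> (\<forall>y\<in>V. c' y = \<sigma> @ \<tau>)"
proof -
  obtain D where D: "D \<subseteq> M" "pairwise (\<lambda>x y. disjnt (mball x \<epsilon>) (mball y \<epsilon>)) D"
    "\<And>x. x \<in> M \<Longrightarrow> \<exists>y\<in>D. mball y \<epsilon> \<subseteq> mball x (3 * \<epsilon>)"
    using disjoint_balls_net[OF \<open>\<epsilon> > 0\<close>] by blast
  have "\<exists>\<sigma> W. disjoint_family W \<and>
      (\<forall>n::nat. nonempty_open (W n) \<and> W n \<subseteq> mball y \<epsilon> \<and> (\<forall>x\<in>W n. c x = \<sigma>))" if "y \<in> D" for y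
  proof -
    have "nonempty_open (mball y \<epsilon>)"
      using D(1) that \<open>\<epsilon> > 0\<close> by (auto simp: nonempty_open_def mball_eq_empty)
    then obtain V \<sigma> where V: "V \<subseteq> mball y \<epsilon>" "nonempty_open V" "\<forall>x\<in>V. c x = \<sigma>"
      using c unfolding locally_decided_def by blast
    moreover obtain W :: "nat \<Rightarrow> 'a set" where
      "\<And>n. openin mtopology (W n) \<and> W n \<noteq> {} \<and> W n \<subseteq> V" "disjoint_family W"
      using disjoint_open_sequence[OF crowded, of V] V(2) unfolding nonempty_open_def by metis
    ultimately show ?thesis
      unfolding nonempty_open_def by (intro exI[of _ \<sigma>] exI[of _ W]) blast
  qed
  then obtain \<sigma> and W :: "'a \<Rightarrow> nat \<Rightarrow> 'a set" where W: "\<And>y. y \<in> D \<Longrightarrow> disjoint_family (W y)"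
      "\<And>y n. y \<in> D \<Longrightarrow> nonempty_open (W y n) \<and> W y n \<subseteq> mball y \<epsilon> \<and> (\<forall>x\<in>W y n. c x = \<sigma> y)"
    by metis
  have uniq: "y = z \<and> m = n" if "y \<in> D" "z \<in> D" "x \<in> W y m" "x \<in> W z n" for x y z m n
  proof -
    have "x \<in> mball y \<epsilon>" "x \<in> mball z \<epsilon>"
      using W(2) that by blast+
    then have "y = z"
      using D(2) that unfolding pairwise_def disjnt_def by blast
    then show ?thesis
      using W(1)[OF that(1)] that unfolding disjoint_family_on_def by blast
  qed
  \<comment> \<open>The index \<open>n\<close> is unique by \<open>uniq\<close>, and
    \<open>from_nat\<close> decodes it into a string. Off the pieces nothing is appended.\<close>
  define \<tau> :: "'a \<Rightarrow> nat list" where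
    "\<tau> x = (if \<exists>y\<in>D. \<exists>n. x \<in> W y n then from_nat (THE n. \<exists>y\<in>D. x \<in> W y n) else [])" for x
  have \<tau>: "\<tau> x = from_nat n" if "y \<in> D" "x \<in> W y n" for x y n
  proof -
    have "(THE n. \<exists>y\<in>D. x \<in> W y n) = n"
      using that uniq by (intro the_equality) blast+
    then show ?thesis
      using that unfolding \<tau>_def by auto
  qed
  let ?c = "\<lambda>x. c x @ \<tau> x"
  show thesis
  proof
    show "locally_decided ?c"
      unfolding locally_decided_def
    proof (intro allI impI)
      fix U assume "nonempty_open U"
      then obtain V \<rho> where V: "V \<subseteq> U" "nonempty_open V" "\<forall>x\<in>V. c x = \<rho>"
        using c unfolding locally_decided_def by blast
      show "\<exists>V\<subseteq>U. nonempty_open V \<and> (\<exists>\<sigma>. \<forall>x\<in>V. ?c x = \<sigma>)"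
      \<comment> \<open>Either \<open>V\<close> meets a piece and shrinks to the intersection, where
        the appended string is constant, or it misses all pieces and only the empty string is
        appended.\<close>
      proof (cases "\<exists>y\<in>D. \<exists>n. V \<inter> W y n \<noteq> {}")
        case True
        then obtain y n where y: "y \<in> D" "V \<inter> W y n \<noteq> {}"
          by blast
        then have "nonempty_open (V \<inter> W y n)"
          using W(2) V(2) unfolding nonempty_open_def by blast
        moreover have "\<forall>x \<in> V \<inter> W y n. ?c x = \<rho> @ from_nat n"
          using V(3) \<tau>[OF y(1)] by auto
        ultimately show ?thesis
          using V(1) by (intro exI[of _ "V \<inter> W y n"]) blast
      next
        case False
        then have "\<forall>x\<in>V. \<tau> x = []"
          unfolding \<tau>_def by auto
        then show ?thesis
          using V by (intro exI[of _ V]) auto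
      qed
    qed
    show "prefix (c x) (?c x)" for x
      by simp
    fix x assume "x \<in> M"
    then obtain y where y: "y \<in> D" "mball y \<epsilon> \<subseteq> mball x (3 * \<epsilon>)"
      using D(3) by blast
    have "W y (to_nat t) \<subseteq> mball x (3 * \<epsilon>) \<and> nonempty_open (W y (to_nat t)) \<and>
        (\<forall>z\<in>W y (to_nat t). ?c z = \<sigma> y @ t)" for t :: "nat list"
      using W(2)[OF y(1), of "to_nat t"] y(2) \<tau>[OF y(1), of _ "to_nat t"] by auto
    then show "\<exists>\<sigma>. \<forall>\<tau>. \<exists>V \<subseteq> mball x (3 * \<epsilon>). nonempty_open V \<and> (\<forall>y\<in>V. ?c y = \<sigma> @ \<tau>)"
      by blast
  qed
qed

end

text \<open>These are the basic open sets of the Baire space. The space is handled through them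
  alone, without a topology on \<open>nat \<Rightarrow> nat\<close>.\<close>

definition cylinder :: "nat list \<Rightarrow> (nat \<Rightarrow> nat) set" where
  "cylinder s = {z. \<forall>i<length s. z i = s ! i}"

context Metric_space
begin

text \<open>Stage \<open>n\<close> extends the strings at scale \<open>\<epsilon> n\<close>, and
  \<open>f x\<close> is the limit of the strings at \<open>x\<close>. An open set contains a ball of
  radius \<open>3 * \<epsilon> n\<close> for some \<open>n\<close>, so stage \<open>n\<close>
  realises all extensions of one string \<open>s\<close> inside it. Later stages only lengthen the
  strings.\<close>

lemma category_map_to_Baire_space:
  assumes crowded: "\<forall>x\<in>M. \<not> openin mtopology {x}"
  obtains f where "\<And>U. nonempty_open U \<Longrightarrow> \<exists>s. \<forall>t. \<exists>V\<subseteq>U. nonempty_open V \<and> f ` V \<subseteq> cylinder (s @ t)"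
proof -
  define \<epsilon> where "\<epsilon> n = inverse (real (Suc n))" for n
  let ?Q = "\<lambda>n c c'. (\<forall>x. prefix (c x) (c' x)) \<and>
    (\<forall>x\<in>M. \<exists>\<sigma>. \<forall>\<tau>. \<exists>V \<subseteq> mball x (3 * \<epsilon> n). nonempty_open V \<and> (\<forall>y\<in>V. c' y = \<sigma> @ \<tau>))"
  have "\<exists>c :: nat \<Rightarrow> 'a \<Rightarrow> nat list. \<forall>n. locally_decided (c n) \<and> ?Q n (c n) (c (Suc n))"
  proof (rule dependent_nat_choice)
    show "\<exists>c :: 'a \<Rightarrow> nat list. locally_decided c"
      by (rule exI[of _ "\<lambda>_. []"]) (auto simp: locally_decided_def)
    fix c :: "'a \<Rightarrow> nat list" and n :: nat
    assume "locally_decided c"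
    moreover have "\<epsilon> n > 0"
      by (simp add: \<epsilon>_def)
    ultimately show "\<exists>c'. locally_decided c' \<and> ?Q n c c'"
      using extend_strings[OF crowded] by metis
  qed
  then obtain c where pre: "\<And>n x. prefix (c n x) (c (Suc n) x)"
    and dense: "\<And>n x. x \<in> M \<Longrightarrow> \<exists>\<sigma>. \<forall>\<tau>. \<exists>V \<subseteq> mball x (3 * \<epsilon> n). nonempty_open V \<and>
        (\<forall>y\<in>V. c (Suc n) y = \<sigma> @ (\<tau> :: nat list))"
    by metis
  have mono: "prefix (c m x) (c n x)" if "m \<le> n" for m n x
    using that by (induction rule: dec_induct) (use pre prefix_order.trans in blast)+
  \<comment> \<open>Coordinate \<open>i\<close> is read off the first string that is long enough;
    longer ones agree by \<open>mono\<close>. If the strings at \<open>x\<close> never reach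
    \<open>i\<close>, the value is arbitrary, which is harmless because the cylinders below
    constrain only coordinates inside a string.\<close>
  define f where "f x i = c (LEAST n. i < length (c n x)) x ! i" for x i
  have f: "f x i = c n x ! i" if "i < length (c n x)" for x i n
  proof -
    let ?m = "LEAST n. i < length (c n x)"
    have "i < length (c ?m x)" "?m \<le> n"
      using that by (rule LeastI, rule Least_le)
    then show ?thesis
      using mono[of ?m n x] unfolding f_def prefix_def by (auto simp: nth_append)
  qed
  show thesis
  proof
    fix U assume "nonempty_open U"
    then obtain x r where x: "x \<in> M" "r > 0" "mball x r \<subseteq> U"
      using nonempty_open_contains_ball unfolding nonempty_open_def by metis
    obtain n where "inverse (real (Suc n)) < r / 3"
      using reals_Archimedean[of "r / 3"] x(2) by auto
    then have sub: "mball x (3 * \<epsilon> n) \<subseteq> U"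
      using mball_subset_concentric[of "3 * \<epsilon> n" r x] x(3) by (simp add: \<epsilon>_def)
    obtain \<sigma> where \<sigma>: "\<And>\<tau>. \<exists>V \<subseteq> mball x (3 * \<epsilon> n). nonempty_open V \<and> (\<forall>y\<in>V. c (Suc n) y = \<sigma> @ \<tau>)"
      using dense[OF x(1)] by blast
    have "\<exists>V\<subseteq>U. nonempty_open V \<and> f ` V \<subseteq> cylinder (\<sigma> @ t)" for t
    proof -
      obtain V where V: "V \<subseteq> mball x (3 * \<epsilon> n)" "nonempty_open V" "\<forall>y\<in>V. c (Suc n) y = \<sigma> @ t"
        using \<sigma> by blast
      then have "f ` V \<subseteq> cylinder (\<sigma> @ t)"
        using f[of _ "Suc n"] by (auto simp: cylinder_def)
      then show ?thesis
        using V sub by blast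
    qed
    then show "\<exists>s. \<forall>t. \<exists>V\<subseteq>U. nonempty_open V \<and> f ` V \<subseteq> cylinder (s @ t)"
      by blast
  qed
qed

text \<open>A sequence \<open>z\<close> steers a descent through balls: its entry at
  \<open>n\<close> selects one of countably many children of the current set. Completeness gives a
  point \<open>g z\<close> in all the sets passed. Every open subset of the current set contains a
  child, so one further entry sends the whole cylinder into it.\<close>

lemma category_map_from_Baire_space:
  assumes "mcomplete" and U: "nonempty_open U"
    and Q: "countable Q" "\<And>V. \<lbrakk>nonempty_open V; V \<subseteq> U\<rbrakk> \<Longrightarrow> Q \<inter> V \<noteq> {}"
  obtains g :: "(nat \<Rightarrow> nat) \<Rightarrow> 'a" where "range g \<subseteq> M"
    "\<And>s. \<exists>W. nonempty_open W \<and> (\<forall>V\<subseteq>W. nonempty_open V \<longrightarrow> (\<exists>t. g ` cylinder (s @ t) \<subseteq> V))"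
proof -
  \<comment> \<open>Centres in \<open>Q\<close> keep the children countable in number,
    \<open>n \<le> k\<close> makes the radii shrink, and closed balls inside \<open>V\<close> make
    the closures nested.\<close>
  define Child where "Child n V = {mball q (inverse (Suc k)) |q k.
    q \<in> Q \<inter> M \<and> n \<le> k \<and> mcball q (inverse (Suc k)) \<subseteq> V}" for n :: nat and V
  have "Child n V \<subseteq> (\<lambda>(q, k). mball q (inverse (Suc k))) ` (Q \<times> UNIV)" for n V
  proof
    fix W assume "W \<in> Child n V"
    then obtain q k where "W = mball q (inverse (Suc k))" "q \<in> Q"
      unfolding Child_def by blast
    then show "W \<in> (\<lambda>(q, k). mball q (inverse (Suc k))) ` (Q \<times> UNIV)"
      by (intro image_eqI[of _ _ "(q, k)"]) auto
  qed
  then have cnt: "countable (Child n V)" for n V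
    by (rule countable_subset) (simp add: Q(1))
  have small: "\<exists>W\<in>Child n V. W \<subseteq> V'" if V': "nonempty_open V'" "V' \<subseteq> V" "V \<subseteq> U" for n V V'
  proof -
    obtain q where q: "q \<in> Q" "q \<in> V'"
      using Q(2)[of V'] V' by blast
    then obtain r where r: "r > 0" "mcball q r \<subseteq> V'"
      using V'(1) unfolding nonempty_open_def openin_mtopology_mcball by blast
    obtain m where m: "inverse (real (Suc m)) < r"
      using reals_Archimedean r(1) by blast
    define k where "k = max m n"
    have "inverse (real (Suc k)) \<le> inverse (real (Suc m))"
      unfolding k_def by (intro le_imp_inverse_le) auto
    then have "inverse (real (Suc k)) \<le> r"
      using m by linarith
    then have "mcball q (inverse (Suc k)) \<subseteq> V'"
      using r(2) mcball_subset_concentric subset_trans by metis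
    moreover have "q \<in> M"
      using that(1) q(2) openin_subset unfolding nonempty_open_def by fastforce
    moreover have "n \<le> k"
      by (simp add: k_def)
    ultimately have "mball q (inverse (Suc k)) \<in> Child n V"
      using q(1) that(2) unfolding Child_def by blast
    then show ?thesis
      using \<open>mcball q (inverse (Suc k)) \<subseteq> V'\<close> mball_subset_mcball by blast
  qed
  \<comment> \<open>\<open>B z n\<close> is the set reached after the first \<open>n\<close> entries
    of \<open>z\<close>, starting from \<open>U\<close>; \<open>from_nat_into\<close> enumerates the
    children.\<close>
  define B where "B z n = rec_nat U (\<lambda>n V. from_nat_into (Child n V) (z n)) n" for z :: "nat \<Rightarrow> nat" and n
  have B0: "B z 0 = U" and BSuc: "B z (Suc n) = from_nat_into (Child n (B z n)) (z n)" for z n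
    by (simp_all add: B_def)
  have child: "nonempty_open W \<and> W \<subseteq> V" if "W \<in> Child n V" for n V W
  proof -
    have "\<exists>q k. W = mball q (inverse (Suc k)) \<and> q \<in> M \<and> mcball q (inverse (Suc k)) \<subseteq> V"
      using that unfolding Child_def by blast
    then obtain q k where q: "W = mball q (inverse (Suc k))" "q \<in> M" "mcball q (inverse (Suc k)) \<subseteq> V"
      by blast
    then have "q \<in> W"
      by simp
    then show ?thesis
      using q mball_subset_mcball[of q] unfolding nonempty_open_def by blast
  qed
  have B: "nonempty_open (B z n) \<and> B z n \<subseteq> U" for z n
  proof (induction n)
    case (Suc n)
    then have "Child n (B z n) \<noteq> {}"
      using small by blast
    then have "B z (Suc n) \<in> Child n (B z n)"
      unfolding BSuc by (rule from_nat_into)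
    then show ?case
      using child Suc by blast
  qed (simp add: B0 U)
  have Child_ne: "Child n (B z n) \<noteq> {}" for n z
    using small B by blast
  have Bchild: "B z (Suc n) \<in> Child n (B z n)" for n z
    unfolding BSuc using Child_ne by (rule from_nat_into)
  \<comment> \<open>The shift to \<open>Suc n\<close> places the closure inside \<open>B z n\<close>
    and in a closed ball of radius \<open>inverse (Suc n)\<close>. The sets \<open>?C z n\<close>
    thus satisfy the nested set criterion for completeness.\<close>
  let ?C = "\<lambda>z n. mtopology closure_of B z (Suc n)"
  have C: "?C z n \<subseteq> B z n" "\<exists>q. ?C z n \<subseteq> mcball q (inverse (Suc n))" for z n
  proof -
    obtain q k where qk: "B z (Suc n) = mball q (inverse (Suc k))" "n \<le> k"
        "mcball q (inverse (Suc k)) \<subseteq> B z n"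
      using Bchild[of z n] unfolding Child_def by blast
    have sub: "?C z n \<subseteq> mcball q (inverse (Suc k))"
      unfolding qk(1) by (rule closure_of_minimal) auto
    then show "?C z n \<subseteq> B z n"
      using qk(3) by blast
    have "inverse (real (Suc k)) \<le> inverse (real (Suc n))"
      using qk(2) by (intro le_imp_inverse_le) auto
    then show "\<exists>q. ?C z n \<subseteq> mcball q (inverse (Suc n))"
      using sub mcball_subset_concentric by blast
  qed
  have BM: "B z n \<subseteq> M" for z n
    using B openin_subset unfolding nonempty_open_def by fastforce
  have "\<Inter>(range (?C z)) \<noteq> {}" for z
  proof -
    have sub: "B z (Suc n) \<subseteq> ?C z n" for n
      using BM by (intro closure_of_subset) simp
    have "decseq (?C z)"
      by (rule decseq_SucI) (rule subset_trans[OF C(1) sub])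
    moreover have "\<exists>n a. ?C z n \<subseteq> mcball a e" if "e > 0" for e
    proof -
      obtain n where "inverse (real (Suc n)) < e"
        using reals_Archimedean \<open>e > 0\<close> by blast
      then show ?thesis
        using C(2)[of z n] mcball_subset_concentric less_imp_le subset_trans by meson
    qed
    moreover have "?C z n \<noteq> {}" for n
      using sub[of n] B[of z "Suc n"] unfolding nonempty_open_def by blast
    ultimately show ?thesis
      using \<open>mcomplete\<close>[unfolded mcomplete_nest, rule_format, of "?C z"] by simp
  qed
  then have "\<forall>z. \<exists>x. x \<in> \<Inter>(range (?C z))"
    by blast
  from choice[OF this] obtain g where g: "\<forall>z. g z \<in> \<Inter>(range (?C z))" ..
  have gB: "g z \<in> B z n" for z n
  proof -
    have "g z \<in> ?C z n"
      using g by blast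
    then show ?thesis
      using C(1) by (rule rev_subsetD)
  qed
  have B_cong: "B y n = B z n" if "\<And>i. i < n \<Longrightarrow> y i = z i" for y z n
    using that by (induction n) (auto simp: B0 BSuc)
  show thesis
  proof
    show "range g \<subseteq> M"
      using gB BM by blast
    fix s :: "nat list"
    define n where "n = length s"
    \<comment> \<open>Entries past the end of \<open>s\<close> are arbitrary; \<open>B z n\<close>
      depends only on the first \<open>n\<close> entries, by \<open>B_cong\<close>.\<close>
    define z where "z i = s ! i" for i
    have "\<exists>t. g ` cylinder (s @ t) \<subseteq> V" if V: "V \<subseteq> B z n" "nonempty_open V" for V
    proof -
      obtain W where W: "W \<in> Child n (B z n)" "W \<subseteq> V"
        using small[OF V(2,1) conjunct2[OF B]] by blast
      then obtain j where j: "from_nat_into (Child n (B z n)) j = W"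
        using from_nat_into_surj[OF cnt] by blast
      have "g y \<in> V" if "y \<in> cylinder (s @ [j])" for y
      proof -
        have y: "\<forall>i<Suc n. y i = (s @ [j]) ! i"
          using that by (auto simp: cylinder_def n_def)
        have "B y n = B z n"
          using y by (intro B_cong) (auto simp: z_def n_def nth_append)
        moreover have "y n = j"
          using y by (auto simp: n_def)
        ultimately have "B y (Suc n) = W"
          using j BSuc by simp
        then show ?thesis
          using gB[of y "Suc n"] W(2) by blast
      qed
      then show ?thesis
        by blast
    qed
    then show "\<exists>W. nonempty_open W \<and> (\<forall>V\<subseteq>W. nonempty_open V \<longrightarrow> (\<exists>t. g ` cylinder (s @ t) \<subseteq> V))"
      using B by blast
  qed
qed

end

section \<open>Comparison with the real line and the two values of the covering number\<close>

lemma cov_meager_le: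
  fixes X :: "'a topology" and Y :: "'b topology"
  assumes X: "metrizable_space X" "\<forall>x \<in> topspace X. \<not> openin X {x}"
    and Y: "completely_metrizable_space Y" "\<forall>y \<in> topspace Y. \<not> openin Y {y}"
    and U: "openin Y U" "U \<noteq> {}" "second_countable (subtopology Y U)"
  shows "cov_meager X \<le>o cov_meager Y"
proof -
  obtain M d where M: "Metric_space M d" "X = Metric_space.mtopology M d"
    using X(1) unfolding metrizable_space_def by blast
  obtain N e where N: "Metric_space N e" "Metric_space.mcomplete N e" "Y = Metric_space.mtopology N e"
    using Y(1) unfolding completely_metrizable_space_def by blast
  interpret M: Metric_space M d by (rule M(1))
  interpret N: Metric_space N e by (rule N(1))
  obtain f where f: "\<And>U. M.nonempty_open U \<Longrightarrow>
      \<exists>s. \<forall>t. \<exists>V\<subseteq>U. M.nonempty_open V \<and> f ` V \<subseteq> cylinder (s @ t)"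
    using M.category_map_to_Baire_space X(2) M(2) by auto
  have "separable_space (subtopology Y U)"
    using U(3) by (rule second_countable_imp_separable_space)
  then obtain Q where Q: "countable Q" "Q \<subseteq> topspace (subtopology Y U)"
      "subtopology Y U closure_of Q = topspace (subtopology Y U)"
    unfolding separable_space_def by blast
  have "Q \<inter> V \<noteq> {}" if "N.nonempty_open V" "V \<subseteq> U" for V
  proof -
    have "openin (subtopology Y U) V"
      using that U(1) N(3) by (simp add: N.nonempty_open_def openin_open_subtopology)
    then show ?thesis
      using Q(3) that(1) openin_subset[of _ V] unfolding N.nonempty_open_def
      by (metis Int_commute inf.absorb1 openin_Int_closure_of_eq_empty)
  qed
  then obtain g :: "(nat \<Rightarrow> nat) \<Rightarrow> 'b" where g: "range g \<subseteq> N"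
    "\<And>s. \<exists>W. N.nonempty_open W \<and> (\<forall>V\<subseteq>W. N.nonempty_open V \<longrightarrow> (\<exists>t. g ` cylinder (s @ t) \<subseteq> V))"
    using N.category_map_from_Baire_space[of U Q] N(2,3) Q(1) U(1,2)
    unfolding N.nonempty_open_def by metis
  show ?thesis
  proof (rule cov_meager_le_vimage)
    show "t1_space Y"
      using Y(1) completely_metrizable_imp_metrizable_space metrizable_imp_t1_space by blast
    show "(g \<circ> f) ` topspace X \<subseteq> topspace Y"
      using g(1) N(3) by auto
    fix A assume A: "nowhere_dense_in Y A"
    show "nowhere_dense_in X ((g \<circ> f) -` A \<inter> topspace X)"
      unfolding nowhere_dense_in_iff
    proof (intro conjI allI impI)
      \<comment> \<open>First \<open>f\<close> yields a string \<open>s\<close> all of whose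
        extensions are realised inside \<open>T\<close>. For this \<open>s\<close>, \<open>g\<close>
        yields \<open>W\<close>, in which some open \<open>V\<close> avoids \<open>A\<close>. An
        extension \<open>s @ t\<close> whose cylinder \<open>g\<close> maps into \<open>V\<close> is
        then realised by \<open>f\<close> on an open subset of \<open>T\<close>.\<close>
      fix T assume T: "openin X T \<and> T \<noteq> {}"
      then obtain s where s: "\<And>t. \<exists>V\<subseteq>T. M.nonempty_open V \<and> f ` V \<subseteq> cylinder (s @ t)"
        using f M(2) unfolding M.nonempty_open_def by metis
      obtain W where W: "N.nonempty_open W"
          "\<And>V. \<lbrakk>V \<subseteq> W; N.nonempty_open V\<rbrakk> \<Longrightarrow> \<exists>t. g ` cylinder (s @ t) \<subseteq> V"
        using g(2) by metis
      then obtain V where V: "V \<subseteq> W" "N.nonempty_open V" "V \<inter> A = {}"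
        using A N(3) unfolding nowhere_dense_in_iff N.nonempty_open_def by metis
      then obtain t where "g ` cylinder (s @ t) \<subseteq> V"
        using W(2) by blast
      moreover obtain V' where "V' \<subseteq> T" "M.nonempty_open V'" "f ` V' \<subseteq> cylinder (s @ t)"
        using s by blast
      ultimately have "V' \<subseteq> T" "openin X V'" "V' \<noteq> {}" "\<forall>x\<in>V'. g (f x) \<notin> A"
        using V(3) M(2) unfolding M.nonempty_open_def by blast+
      then show "\<exists>V\<subseteq>T. openin X V \<and> V \<noteq> {} \<and> V \<inter> ((g \<circ> f) -` A \<inter> topspace X) = {}"
        by (intro exI[of _ V']) auto
    qed blast
  qed fact
qed

text \<open>\<open>cov_meager_le\<close> asks only the target for a second countable open set. The
  reals provide the whole line and \<open>X\<close> provides \<open>U\<close>, so it applies in both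
  directions.\<close>

lemma cov_meager_eq_cov_meager_real:
  assumes X: "completely_metrizable_space X" "\<forall>x \<in> topspace X. \<not> openin X {x}"
    and U: "openin X U" "U \<noteq> {}" "second_countable (subtopology X U)"
  shows "cov_meager X =o cov_meager (euclidean :: real topology)"
proof -
  have mX: "metrizable_space X"
    using X(1) by (rule completely_metrizable_imp_metrizable_space)
  have R: "completely_metrizable_space (euclidean :: real topology)"
      "metrizable_space (euclidean :: real topology)"
      "\<forall>x \<in> topspace (euclidean :: real topology). \<not> openin euclidean {x}"
    using completely_metrizable_space_euclidean completely_metrizable_imp_metrizable_space
    by (auto simp: not_open_singleton)
  obtain B :: "real set set" where "countable B" "\<And>C. C \<in> B \<Longrightarrow> open C"
      "\<And>S. open S \<Longrightarrow> \<exists>U. U \<subseteq> B \<and> S = \<Union>U"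
    using univ_second_countable by blast
  then have "second_countable (euclidean :: real topology)"
    unfolding second_countable_def open_openin[symmetric]
    by (intro exI[of _ B]) (metis Union_iff Union_upper subsetD)
  then have sR: "second_countable (subtopology (euclidean :: real topology) UNIV)"
    by simp
  have "cov_meager X \<le>o cov_meager (euclidean :: real topology)"
    using cov_meager_le[OF mX X(2) R(1,3) _ _ sR] by simp
  moreover have "cov_meager (euclidean :: real topology) \<le>o cov_meager X"
    using cov_meager_le[OF R(2,3) X U] .
  ultimately show ?thesis
    by (simp add: ordIso_iff_ordLeq)
qed

text \<open>The upper bound comes from a nowhere dense cover indexed by a set of size
  \<open>cardSuc natLeq\<close>. The lower bound holds because meager covers are
  uncountable.\<close>

lemma cov_meager_eq_aleph1:
  assumes X: "completely_metrizable_space X" "topspace X \<noteq> {}" "\<forall>x \<in> topspace X. \<not> openin X {x}"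
    and nsc: "\<And>U. \<lbrakk>openin X U; U \<noteq> {}\<rbrakk> \<Longrightarrow> \<not> second_countable (subtopology X U)"
  shows "cov_meager X =o cardSuc natLeq"
proof -
  obtain M d where M: "Metric_space M d" "X = Metric_space.mtopology M d"
    using X(1) unfolding completely_metrizable_space_def by blast
  interpret Metric_space M d by (rule M(1))
  define I where "I = Field (cardSuc natLeq)"
  have I: "|I| =o cardSuc natLeq"
    unfolding I_def using cardSuc_Card_order natLeq_Card_order card_of_Field_ordIso by blast
  have unc: "uncountable I"
    using I cardSuc_greater[OF natLeq_Card_order] countable_card_le_natLeq
      not_ordLess_ordLeq ordIso_symmetric ordLess_ordIso_trans by blast
  have "\<exists>W. disjoint_family_on W I \<and> (\<forall>i\<in>I. openin mtopology (W i) \<and> W i \<noteq> {} \<and> W i \<subseteq> V)"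
    if "openin mtopology V" "V \<noteq> {}" for V
    using uncountable_disjoint_open_family[OF that(1) _ ordIso_imp_ordLeq[OF I]] nsc[of V] that M(2)
    by metis
  then obtain Z where Z: "\<And>i. i \<in> I \<Longrightarrow> nowhere_dense_in mtopology (Z i)" "(\<Union>i\<in>I. Z i) = M"
    using nowhere_dense_cover[OF unc] by metis
  have "cov_meager X \<le>o |Z ` I|"
    unfolding cov_meager_def
  proof (rule cov_least)
    show "Z ` I \<subseteq> meager_sets X"
      using Z(1) M(2) countable_union_of_inc unfolding meager_sets_def by blast
    show "\<Union>(Z ` I) = topspace X"
      using Z(2) M(2) by simp
  qed
  also have "|Z ` I| \<le>o |I|"
    by (rule card_of_image)
  also have "|I| =o cardSuc natLeq"
    by (rule I)
  finally have "cov_meager X \<le>o cardSuc natLeq" .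
  moreover have "cardSuc natLeq \<le>o cov_meager X"
  proof -
    have "t1_space X"
      using X(1) completely_metrizable_imp_metrizable_space metrizable_imp_t1_space by blast
    then obtain J where J: "J \<subseteq> meager_sets X" "\<Union>J = topspace X" "cov_meager X = |J|"
      using cov_meager_attained X(3) by blast
    then have "\<not> |J| \<le>o natLeq"
      using uncountable_meager_cover[OF X(1,2)] countable_card_le_natLeq by metis
    then have "natLeq <o |J|"
      using not_ordLeq_iff_ordLess card_of_Well_order natLeq_Well_order by blast
    then show ?thesis
      using J(3) cardSuc_least natLeq_Card_order card_of_Card_order by metis
  qed
  ultimately show ?thesis
    by (simp add: ordIso_iff_ordLeq)
qed

theorem theorem2p4:
  fixes X :: "'a topology"
  assumes "topspace X \<noteq> {}"
    and "completely_metrizable_space X"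
    and no_isolated_points: "\<forall>x \<in> topspace X. \<not> openin X {x}"
  shows "natLeq \<le>o weight_down X
    \<and> (weight_down X =o natLeq \<longrightarrow> cov_meager X =o cov_meager (euclidean :: real topology))
    \<and> (natLeq <o weight_down X \<longrightarrow> cov_meager X =o cardSuc natLeq)"
proof (intro conjI impI)
  \<comment> \<open>This bound makes the two cases exhaustive.\<close>
  show "natLeq \<le>o weight_down X"
    using assms completely_metrizable_imp_metrizable_space metrizable_imp_Hausdorff_space
    by (blast intro: natLeq_le_weight_down)
  show "cov_meager X =o cov_meager (euclidean :: real topology)" if "weight_down X =o natLeq"
  proof -
    obtain U where U: "openin X U" "U \<noteq> {}" "weight_down X = weight (subtopology X U)"
      using weight_down_attained assms(1) .
    then have "second_countable (subtopology X U)"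
      using that by (simp add: second_countable_iff_weight ordIso_iff_ordLeq)
    then show ?thesis
      using cov_meager_eq_cov_meager_real assms(2,3) U(1,2) by blast
  qed
  show "cov_meager X =o cardSuc natLeq" if "natLeq <o weight_down X"
  proof (rule cov_meager_eq_aleph1)
    \<comment> \<open>A second countable \<open>U\<close> would bound \<open>weight_down X\<close>
      by \<open>natLeq\<close>.\<close>
    show "\<not> second_countable (subtopology X U)" if U: "openin X U" "U \<noteq> {}" for U
      using weight_down_least[OF U] \<open>natLeq <o weight_down X\<close> second_countable_iff_weight
        ordLess_ordLeq_trans not_ordLess_ordLeq by blast
  qed (use assms in blast)+
qed

end
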